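(* Let $A$ and $B$ be Q-systems in $\mathbf{Hilb}$ and let $(H,Q_1,Q_2)$ be a quantum bi-element of the pair $(A,B)$. Then the linear map $P:=Q_1Q_2^*: H\otimes B\to A\otimes H$ defines a non-unital quantum function $(H,P)$ from $B$ to $A$.
   Context: $\mathbf{Hilb}$ is the category of finite dimensional Hilbert spaces and linear maps (treated as a strict monoidal category). A Q-system in $\mathbf{Hilb}$ is a finite dimensional Hilbert space $A$ with linear maps $m_A:A\otimes A\to A$ and $i_A:\mathbb{C}\to A$ satisfying associativity $m_A(m_A\otimes 1)=m_A(1\otimes m_A)$, unitality $m_A(i_A\otimes 1)=1_A=m_A(1\otimes i_A)$, the Frobenius condition $(m_A\otimes 1)(1\otimes m_A^* )=m_A^*m_A=(1\otimes m_A)(m_A^*\otimes 1)$, and separability $m_Am_A^*=1_A$. A quantum bi-element of a pair $(A,B)$ of Q-systems in $\mathbf{Hilb}$ is a triple $(H,Q_1,Q_2)$ with $H$ a finite dimensional Hilbert space and $Q_1:H\to A\otimes H$, $Q_2:H\to H\otimes B$ linear maps such that (1) $(1_A\otimes Q_1)Q_1=(m_A^*\otimes 1_H)Q_1$, $(Q_2\otimes 1_B)Q_2=(1_H\otimes m_B^* )Q_2$, and $(1_A\otimes Q_2)Q_1=(Q_1\otimes 1_B)Q_2$; (2) $(i_A^*\otimes 1_H)Q_1=1_H=(1_H\otimes i_B^* )Q_2$; (3) $Q_1^*=(i_A^*m_A\otimes 1_H)(1_A\otimes Q_1)$ and $Q_2^*=(1_H\otimes i_B^*m_B)(Q_2\otimes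 1_B)$. A quantum function from a Q-system $B$ to a Q-system $A$ is a pair $(H,P)$ with $H$ a finite dimensional Hilbert space and $P:H\otimes B\to A\otimes H$ linear such that (a) $(m_A^*\otimes 1_H)P=(1_A\otimes P)(P\otimes 1_B)(1_H\otimes m_B^* )$; (b) $(i_A^*\otimes 1_H)P=1_H\otimes i_B^*$; (c) $P^*=(i_A^*m_A\otimes 1_H\otimes 1_B)(1_A\otimes P\otimes 1_B)(1_A\otimes 1_H\otimes m_B^*i_B)$. A non-unital quantum function is such a pair required to satisfy (a) and (c), with condition (b) dropped (not required). *)

theory Defs
  imports Complex_Main
begin

section \<open>Finite-dimensional complex Hilbert spaces\<close>

class complex_vector = ab_group_add +
  fixes scaleC :: "complex \<Rightarrow> 'a \<Rightarrow> 'a" (infixr "*\<^sub>C" 75)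
  assumes scaleC_add_right: "c *\<^sub>C (x + y) = c *\<^sub>C x + c *\<^sub>C y"
    and scaleC_add_left: "(c + d) *\<^sub>C x = c *\<^sub>C x + d *\<^sub>C x"
    and scaleC_scaleC: "c *\<^sub>C (d *\<^sub>C x) = (c * d) *\<^sub>C x"
    and scaleC_one: "1 *\<^sub>C x = x"

global_interpretation cvec: vector_space "scaleC :: complex \<Rightarrow> 'a \<Rightarrow> 'a::complex_vector"
  by unfold_locales (simp_all add: scaleC_add_right scaleC_add_left scaleC_scaleC scaleC_one)

abbreviation clinear :: "('a::complex_vector \<Rightarrow> 'b::complex_vector) \<Rightarrow> bool"
  where "clinear \<equiv> Vector_Spaces.linear scaleC scaleC"

text \<open>The inner product is antilinear in its first argument.  A finite-dimensional inner product
  space is automatically complete, so completeness is not mentioned.  The zero space is allowed.\<close>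

class hilbert_fd = complex_vector +
  fixes cinner :: "'a \<Rightarrow> 'a \<Rightarrow> complex"
  assumes cinner_commute: "cinner x y = cnj (cinner y x)"
    and cinner_add_right: "cinner x (y + z) = cinner x y + cinner x z"
    and cinner_scaleC_right: "cinner x (c *\<^sub>C y) = c * cinner x y"
    and cinner_pos: "x \<noteq> 0 \<Longrightarrow> 0 < Re (cinner x x)"
    and finite_spanning: "\<exists>B. finite B \<and> (\<forall>x. \<exists>c. x = (\<Sum>b\<in>B. c b *\<^sub>C b))"

lemma spanning_iff:
  assumes "finite (B :: 'a::complex_vector set)"
  shows "(\<forall>x. \<exists>c. x = (\<Sum>b\<in>B. c b *\<^sub>C b)) \<longleftrightarrow> cvec.span B = UNIV"
  unfolding cvec.span_finite[OF assms] by (auto simp: set_eq_iff image_iff)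


lemma clinearI:
  assumes "\<And>x y. f (x + y) = f x + f y" and "\<And>c x. f (c *\<^sub>C x) = c *\<^sub>C f x"
  shows "clinear f"
  using assms by (intro Vector_Spaces.linear.intro module_hom.intro module_hom_axioms.intro
      cvec.vector_space_axioms cvec.module_axioms) auto

lemma clinear_add: "clinear f \<Longrightarrow> f (x + y) = f x + f y"
  by (drule Vector_Spaces.linear.axioms(3)) (rule module_hom.add)

lemma clinear_scale: "clinear f \<Longrightarrow> f (c *\<^sub>C x) = c *\<^sub>C f x"
  by (drule Vector_Spaces.linear.axioms(3)) (rule module_hom.scale)

lemma clinear_zero: "clinear f \<Longrightarrow> f 0 = 0"
  by (drule Vector_Spaces.linear.axioms(3)) (rule module_hom.zero)

lemma clinear_sum: "clinear f \<Longrightarrow> f (sum g A) = (\<Sum>x\<in>A. f (g x))"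
  by (induction A rule: infinite_finite_induct) (simp_all add: clinear_zero clinear_add)

lemma clinear_id: "clinear (id :: 'a::complex_vector \<Rightarrow> 'a)"
  by (rule clinearI) auto

lemma clinear_comp: "clinear f \<Longrightarrow> clinear g \<Longrightarrow> clinear (g \<circ> f)"
  by (rule clinearI) (auto simp: clinear_add clinear_scale)

lemma cinner_add_left: "cinner (x + y) z = cinner x z + cinner (y :: 'a::hilbert_fd) z"
  by (metis cinner_commute cinner_add_right complex_cnj_add)

lemma cinner_scaleC_left: "cinner (c *\<^sub>C x) y = cnj c * cinner x (y :: 'a::hilbert_fd)"
  by (metis cinner_commute cinner_scaleC_right complex_cnj_mult)

lemma cinner_zero_right [simp]: "cinner (x :: 'a::hilbert_fd) 0 = 0"
  using cinner_add_right[of x 0 0] by simp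

lemma cinner_zero_left [simp]: "cinner 0 (x :: 'a::hilbert_fd) = 0"
  using cinner_add_left[of 0 0 x] by simp

lemma cinner_diff_right: "cinner x (y - z) = cinner x y - cinner x (z :: 'a::hilbert_fd)"
  using cinner_add_right[of x "y - z" z] by simp

lemma cinner_sum_right: "cinner x (sum g A) = (\<Sum>a\<in>A. cinner x (g a :: 'a::hilbert_fd))"
  by (induction A rule: infinite_finite_induct) (simp_all add: cinner_add_right)

lemma cinner_sum_left: "cinner (sum g A) x = (\<Sum>a\<in>A. cinner (g a :: 'a::hilbert_fd) x)"
  by (induction A rule: infinite_finite_induct) (simp_all add: cinner_add_left)

lemma cinner_eq_zero: "cinner x x = 0 \<longleftrightarrow> (x :: 'a::hilbert_fd) = 0"
  using cinner_pos[of x] by (cases "x = 0") auto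

lemma cinner_eqI:
  assumes "\<And>z. cinner z x = cinner z (y :: 'a::hilbert_fd)" shows "x = y"
  using assms[of "x - y"] cinner_eq_zero[of "x - y"] by (simp add: cinner_diff_right)

definition orthonormal :: "'a::hilbert_fd set \<Rightarrow> bool"
  where "orthonormal E \<longleftrightarrow> (\<forall>x\<in>E. \<forall>y\<in>E. cinner x y = (if x = y then 1 else 0))"

definition onb :: "'a::hilbert_fd set \<Rightarrow> bool"
  where "onb E \<longleftrightarrow> finite E \<and> orthonormal E \<and> cvec.span E = UNIV"

lemma orthonormal_residual:
  assumes "finite E" "orthonormal E" "e \<in> E"
  shows "cinner e (x - (\<Sum>f\<in>E. cinner f x *\<^sub>C f)) = 0"
proof -
  have "cinner e (\<Sum>f\<in>E. cinner f x *\<^sub>C f) = (\<Sum>f\<in>E. if f = e then cinner e x else 0)"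
    unfolding cinner_sum_right cinner_scaleC_right
    using assms by (intro sum.cong refl) (auto simp: orthonormal_def)
  then show ?thesis using assms by (simp add: cinner_diff_right)
qed

lemma gram_schmidt:
  assumes "finite (S :: 'a::hilbert_fd set)"
  shows "\<exists>E. finite E \<and> orthonormal E \<and> cvec.span S \<subseteq> cvec.span E"
  using assms
proof (induction S rule: finite_induct)
  case empty
  show ?case by (rule exI[of _ "{}"]) (simp add: orthonormal_def)
next
  case (insert x S)
  then obtain E where E: "finite E" "orthonormal E" "cvec.span S \<subseteq> cvec.span E" by auto
  define p where "p = (\<Sum>f\<in>E. cinner f x *\<^sub>C f)"
  define r where "r = x - p"
  have pE: "p \<in> cvec.span E"
    unfolding p_def by (intro cvec.span_sum cvec.span_scale cvec.span_base)
  have xr: "x = p + r" by (simp add: r_def)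
  have SE: "S \<subseteq> cvec.span E" using E(3) cvec.span_superset by blast
  show ?case
  proof (cases "r = 0")
    case True
    then have "x \<in> cvec.span E" using xr pE by simp
    then have "cvec.span (insert x S) \<subseteq> cvec.span E"
      using SE by (intro cvec.span_minimal) auto
    then show ?thesis using E by blast
  next
    case False
    define n where "n = sqrt (Re (cinner r r))"
    have npos: "n > 0" using cinner_pos[OF False] by (simp add: n_def)
    have n2: "n * n = Re (cinner r r)" using cinner_pos[OF False] by (simp add: n_def)
    have "Im (cinner r r) = 0" using arg_cong[OF cinner_commute[of r r], of Im] by simp
    then have rr: "cinner r r = of_real n * of_real n"
      by (metis complex_is_Real_iff n2 of_real_Re of_real_mult)
    define u where "u = (1 / complex_of_real n) *\<^sub>C r"
    have ru: "r = of_real n *\<^sub>C u" using npos by (simp add: u_def)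
    have eu: "cinner e u = 0" if "e \<in> E" for e
      using orthonormal_residual[OF E(1,2) that, of x]
      by (simp add: u_def cinner_scaleC_right r_def p_def)
    have ue: "cinner u e = 0" if "e \<in> E" for e
      using eu[OF that] cinner_commute[of u e] by simp
    have uu: "cinner u u = 1"
      using npos by (simp add: u_def cinner_scaleC_right cinner_scaleC_left rr)
    have on: "orthonormal (insert u E)"
      using E(2) eu ue uu unfolding orthonormal_def by (metis insert_iff zero_neq_one)
    have sub: "cvec.span E \<subseteq> cvec.span (insert u E)" by (intro cvec.span_mono) auto
    have "x \<in> cvec.span (insert u E)"
      unfolding xr by (subst ru)
        (intro cvec.span_add cvec.span_scale cvec.span_base subsetD[OF sub pE], simp)
    then have "cvec.span (insert x S) \<subseteq> cvec.span (insert u E)"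
      using SE sub by (intro cvec.span_minimal) auto
    then show ?thesis using E(1) on by (intro exI[of _ "insert u E"]) auto
  qed
qed

lemma onb_exists: "\<exists>E :: 'a::hilbert_fd set. onb E"
proof -
  obtain B :: "'a set" where B: "finite B" "\<forall>x. \<exists>c. x = (\<Sum>b\<in>B. c b *\<^sub>C b)"
    using finite_spanning by (elim exE conjE)
  then have "cvec.span B = UNIV" by (simp only: spanning_iff)
  then show ?thesis using gram_schmidt[OF B(1)] unfolding onb_def by auto
qed

lemma onb_expand:
  assumes "onb E" shows "(\<Sum>e\<in>E. cinner e x *\<^sub>C e) = (x :: 'a::hilbert_fd)"
proof -
  define r where "r = x - (\<Sum>e\<in>E. cinner e x *\<^sub>C e)"
  have E: "finite E" "orthonormal E" "cvec.span E = UNIV" using assms by (auto simp: onb_def)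
  have r0: "cinner r e = 0" if "e \<in> E" for e
    using orthonormal_residual[OF E(1,2) that, of x] cinner_commute[of r e] by (simp add: r_def)
  have "cvec.span E \<subseteq> {y. cinner r y = 0}"
    using r0 by (intro cvec.span_minimal)
      (auto simp: cvec.subspace_def cinner_add_right cinner_scaleC_right)
  then have "cinner r r = 0" using E by auto
  then show ?thesis by (simp add: cinner_eq_zero r_def)
qed

instantiation complex :: hilbert_fd
begin
definition "scaleC = ((*) :: complex \<Rightarrow> complex \<Rightarrow> complex)"
definition "cinner w z = cnj w * (z :: complex)"
instance
proof
  show vs: "c *\<^sub>C (x + y) = c *\<^sub>C x + c *\<^sub>C y" "(c + d) *\<^sub>C x = c *\<^sub>C x + d *\<^sub>C x"
    "c *\<^sub>C (d *\<^sub>C x) = (c * d) *\<^sub>C x" "1 *\<^sub>C x = x" for c d x y :: complex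
    by (auto simp: scaleC_complex_def algebra_simps)
  show "cinner x y = cnj (cinner y x)" for x y :: complex by (simp add: cinner_complex_def)
  show "cinner x (y + z) = cinner x y + cinner x z" for x y z :: complex
    by (simp add: cinner_complex_def algebra_simps)
  show "cinner x (c *\<^sub>C y) = c * cinner x y" for c x y :: complex
    by (simp add: cinner_complex_def scaleC_complex_def)
  show "0 < Re (cinner x x)" if "x \<noteq> 0" for x :: complex
  proof -
    have "cinner x x = of_real ((cmod x)\<^sup>2)"
      using complex_norm_square[of x] by (simp add: cinner_complex_def mult.commute)
    then show ?thesis using that by simp
  qed
  show "\<exists>B. finite B \<and> (\<forall>x :: complex. \<exists>c. x = (\<Sum>b\<in>B. c b *\<^sub>C b))"
    by (intro exI[of _ "{1}"]) (auto simp: scaleC_complex_def intro: exI[of _ "\<lambda>_. _"])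
qed
end

definition adj :: "('a::hilbert_fd \<Rightarrow> 'b::hilbert_fd) \<Rightarrow> 'b \<Rightarrow> 'a" ("_\<^sup>\<dagger>" [1000] 1000)
  where "f\<^sup>\<dagger> = (THE g. \<forall>x y. cinner (g y) x = cinner y (f x))"

lemma cinner_adj:
  fixes f :: "'a::hilbert_fd \<Rightarrow> 'b::hilbert_fd"
  assumes "clinear f" shows "cinner (f\<^sup>\<dagger> y) x = cinner y (f x)"
proof -
  obtain E :: "'a set" where E: "onb E" using onb_exists by blast
  define g where "g y = (\<Sum>e\<in>E. cinner (f e) y *\<^sub>C e)" for y
  have g: "\<forall>x y. cinner (g y) x = cinner y (f x)"
  proof (intro allI)
    fix x y
    have "cinner y (f x) = cinner y (f (\<Sum>e\<in>E. cinner e x *\<^sub>C e))" using onb_expand[OF E] by simp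
    also have "\<dots> = (\<Sum>e\<in>E. cinner e x * cinner y (f e))"
      using assms by (simp add: clinear_sum clinear_scale cinner_sum_right cinner_scaleC_right)
    also have "\<dots> = cinner (g y) x"
      unfolding g_def cinner_sum_left cinner_scaleC_left
      by (intro sum.cong refl) (metis cinner_commute mult.commute)
    finally show "cinner (g y) x = cinner y (f x)" by simp
  qed
  have "h = g" if "\<forall>x y. cinner (h y) x = cinner y (f x)" for h
  proof (rule ext, rule cinner_eqI)
    fix y z
    have "cinner (h y) z = cinner (g y) z" using that g by simp
    then show "cinner z (h y) = cinner z (g y)"
      using cinner_commute[of z "h y"] cinner_commute[of z "g y"] by simp
  qed
  then have "f\<^sup>\<dagger> = g" unfolding adj_def by (intro the_equality g)
  then show ?thesis using g by simp
qed


section \<open>Tensor products\<close>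

text \<open>The tensor product of \<open>A\<close> and \<open>B\<close> is realised as the space of antilinear maps \<open>A \<Rightarrow> B\<close> with
  the Hilbert--Schmidt inner product; the pure tensor of \<open>x\<close> and \<open>y\<close> is the map sending \<open>a\<close> to
  \<open>cinner a x *\<^sub>C y\<close>.  That this is the Hilbert space tensor product is confirmed below by
  \<open>cinner_pure\<close> and the universal property \<open>tensor_universal\<close>.\<close>

definition antilinear :: "('a::complex_vector \<Rightarrow> 'b::complex_vector) \<Rightarrow> bool"
  where "antilinear f \<longleftrightarrow>
    (\<forall>x y. f (x + y) = f x + f y) \<and> (\<forall>c x. f (c *\<^sub>C x) = cnj c *\<^sub>C f x)"

typedef (overloaded) ('a, 'b) tensor (infixr "\<otimes>" 76) =
  "{f :: 'a::hilbert_fd \<Rightarrow> 'b::hilbert_fd. antilinear f}"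
  by (rule exI[of _ "\<lambda>_. 0"]) (simp add: antilinear_def)

setup_lifting type_definition_tensor

lift_definition pure :: "'a::hilbert_fd \<Rightarrow> 'b::hilbert_fd \<Rightarrow> 'a \<otimes> 'b" (infixr "\<otimes>" 76)
  is "\<lambda>x y a. cinner a x *\<^sub>C y"
  by (simp add: antilinear_def cinner_add_left cinner_scaleC_left scaleC_add_left scaleC_scaleC)

lemma Rep_add: "Rep_tensor t (x + y) = Rep_tensor t x + Rep_tensor t y"
  using Rep_tensor[of t] by (simp add: antilinear_def)

lemma Rep_scale: "Rep_tensor t (c *\<^sub>C x) = cnj c *\<^sub>C Rep_tensor t x"
  using Rep_tensor[of t] by (simp add: antilinear_def)

lemma Rep_zero: "Rep_tensor t 0 = 0"
  using Rep_add[of t 0 0] by simp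

lemma Rep_sum: "Rep_tensor t (sum g A) = (\<Sum>a\<in>A. Rep_tensor t (g a))"
  by (induction A rule: infinite_finite_induct) (simp_all add: Rep_zero Rep_add)

instantiation tensor :: (hilbert_fd, hilbert_fd) complex_vector
begin
lift_definition zero_tensor :: "'a \<otimes> 'b" is "\<lambda>_. 0" by (simp add: antilinear_def)
lift_definition plus_tensor :: "'a \<otimes> 'b \<Rightarrow> 'a \<otimes> 'b \<Rightarrow> 'a \<otimes> 'b" is "\<lambda>f g x. f x + g x"
  by (simp add: antilinear_def scaleC_add_right)
lift_definition uminus_tensor :: "'a \<otimes> 'b \<Rightarrow> 'a \<otimes> 'b" is "\<lambda>f x. - f x"
  by (simp add: antilinear_def)
lift_definition minus_tensor :: "'a \<otimes> 'b \<Rightarrow> 'a \<otimes> 'b \<Rightarrow> 'a \<otimes> 'b" is "\<lambda>f g x. f x - g x"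
  by (simp add: antilinear_def cvec.scale_right_diff_distrib)
lift_definition scaleC_tensor :: "complex \<Rightarrow> 'a \<otimes> 'b \<Rightarrow> 'a \<otimes> 'b" is "\<lambda>c f x. c *\<^sub>C f x"
  by (simp add: antilinear_def scaleC_add_right scaleC_scaleC mult.commute)
instance
  by standard (transfer; auto simp: fun_eq_iff scaleC_add_right scaleC_add_left scaleC_scaleC)+
end

lemma Rep_tensor_sum: "Rep_tensor (sum t A) x = (\<Sum>a\<in>A. Rep_tensor (t a) x)"
  by (induction A rule: infinite_finite_induct)
    (simp_all add: zero_tensor.rep_eq plus_tensor.rep_eq)

lemma onb_tensor_expand:
  assumes "onb E" shows "(\<Sum>e\<in>E. e \<otimes> Rep_tensor t e) = t"
proof -
  have "Rep_tensor (\<Sum>e\<in>E. e \<otimes> Rep_tensor t e) x = Rep_tensor t x" for x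
  proof -
    have "Rep_tensor t x = Rep_tensor t (\<Sum>e\<in>E. cinner e x *\<^sub>C e)" using onb_expand[OF assms] by simp
    also have "\<dots> = (\<Sum>e\<in>E. cinner x e *\<^sub>C Rep_tensor t e)"
      by (simp add: Rep_sum Rep_scale cinner_commute[symmetric])
    finally show ?thesis by (simp add: Rep_tensor_sum pure.rep_eq)
  qed
  then show ?thesis by (auto simp: Rep_tensor_inject[symmetric])
qed

lemma pure_add_left: "(x + y) \<otimes> z = x \<otimes> z + y \<otimes> z"
  by transfer (simp add: fun_eq_iff cinner_add_right scaleC_add_left)

lemma pure_add_right: "x \<otimes> (y + z) = x \<otimes> y + x \<otimes> z"
  by transfer (simp add: fun_eq_iff scaleC_add_right)

lemma pure_scale_left: "(c *\<^sub>C x) \<otimes> y = c *\<^sub>C (x \<otimes> y)"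
  by transfer (simp add: fun_eq_iff cinner_scaleC_right scaleC_scaleC)

lemma pure_scale_right: "x \<otimes> (c *\<^sub>C y) = c *\<^sub>C (x \<otimes> y)"
  by transfer (simp add: fun_eq_iff scaleC_scaleC mult.commute)

lemma clinear_pure_right: "clinear (\<lambda>y. x \<otimes> y)"
  by (rule clinearI) (simp_all add: pure_add_right pure_scale_right)

lemma clinear_pure_left: "clinear (\<lambda>x. x \<otimes> y)"
  by (rule clinearI) (simp_all add: pure_add_left pure_scale_left)

lemma pure_span: "cvec.span {x \<otimes> y | (x :: 'a::hilbert_fd) (y :: 'b::hilbert_fd). True} = UNIV"
proof -
  obtain E :: "'a set" where E: "onb E" using onb_exists by blast
  have "t \<in> cvec.span {x \<otimes> y | x y. True}" for t :: "'a \<otimes> 'b"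
    by (subst onb_tensor_expand[OF E, symmetric]) (intro cvec.span_sum cvec.span_base, auto)
  then show ?thesis by auto
qed

lemma finite_span_tensor:
  "\<exists>B :: ('a::hilbert_fd \<otimes> 'b::hilbert_fd) set. finite B \<and> cvec.span B = UNIV"
proof -
  obtain E :: "'a set" where E: "onb E" using onb_exists by blast
  obtain F :: "'b set" where F: "onb F" using onb_exists by blast
  define B where "B = (\<lambda>(e, f). e \<otimes> f) ` (E \<times> F)"
  have "t \<in> cvec.span B" for t :: "'a \<otimes> 'b"
  proof -
    have "e \<otimes> y \<in> cvec.span B" if "e \<in> E" for e y
    proof -
      have "e \<otimes> y = (\<Sum>f\<in>F. cinner f y *\<^sub>C (e \<otimes> f))"
        by (subst onb_expand[OF F, of y, symmetric])
          (simp add: clinear_sum[OF clinear_pure_right] pure_scale_right)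
      also have "\<dots> \<in> cvec.span B"
        using that by (intro cvec.span_sum cvec.span_scale cvec.span_base) (auto simp: B_def)
      finally show ?thesis .
    qed
    then show ?thesis
      by (subst onb_tensor_expand[OF E, symmetric]) (intro cvec.span_sum, auto)
  qed
  moreover have "finite B" using E F by (auto simp: B_def onb_def)
  ultimately show ?thesis by blast
qed

text \<open>The value of the inner product does not depend on the orthonormal basis chosen
  (see \<open>cinner_pure\<close>).\<close>

instantiation tensor :: (hilbert_fd, hilbert_fd) hilbert_fd
begin
definition "cinner (s :: 'a \<otimes> 'b) t =
  (\<Sum>e\<in>(SOME E. onb E). cinner (Rep_tensor s e) (Rep_tensor t e))"
instance
proof
  define E where "E = (SOME E :: 'a set. onb E)"
  have E: "onb E" unfolding E_def by (rule someI_ex[OF onb_exists])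
  have ci: "cinner s t = (\<Sum>e\<in>E. cinner (Rep_tensor s e) (Rep_tensor t e))" for s t :: "'a \<otimes> 'b"
    by (simp add: cinner_tensor_def E_def)
  show "cinner x y = cnj (cinner y x)" for x y :: "'a \<otimes> 'b"
    by (simp add: ci cinner_commute[symmetric])
  show "cinner x (y + z) = cinner x y + cinner x z" for x y z :: "'a \<otimes> 'b"
    by (simp add: ci plus_tensor.rep_eq cinner_add_right sum.distrib)
  show "cinner x (c *\<^sub>C y) = c * cinner x y" for c and x y :: "'a \<otimes> 'b"
    by (simp add: ci scaleC_tensor.rep_eq cinner_scaleC_right sum_distrib_left)
  show "0 < Re (cinner x x)" if "x \<noteq> 0" for x :: "'a \<otimes> 'b"
  proof -
    have nn: "0 \<le> Re (cinner y y)" for y :: 'b using cinner_pos[of y] by (cases "y = 0") auto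
    have "\<exists>e\<in>E. Rep_tensor x e \<noteq> 0"
    proof (rule ccontr)
      assume "\<not> ?thesis"
      then have "Rep_tensor x e = Rep_tensor 0 e" if "e \<in> E" for e
        using that by (simp add: zero_tensor.rep_eq)
      then have "x = 0"
        using onb_tensor_expand[OF E, of x] onb_tensor_expand[OF E, of "0 :: 'a \<otimes> 'b"]
        by (metis (no_types, lifting) sum.cong)
      with that show False by simp
    qed
    then obtain e where "e \<in> E" "Rep_tensor x e \<noteq> 0" by blast
    then show ?thesis
      using E cinner_pos[of "Rep_tensor x e"] nn unfolding ci Re_sum
      by (intro sum_pos2[of E e]) (auto simp: onb_def)
  qed
  show "\<exists>B. finite B \<and> (\<forall>x :: 'a \<otimes> 'b. \<exists>c. x = (\<Sum>b\<in>B. c b *\<^sub>C b))"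
  proof -
    obtain B :: "('a \<otimes> 'b) set" where "finite B" "cvec.span B = UNIV"
      using finite_span_tensor by blast
    then show ?thesis by (intro exI[of _ B]) (simp only: spanning_iff simp_thms)
  qed
qed
end

lemma cinner_pure: "cinner (x \<otimes> y) (x' \<otimes> y') = cinner x x' * cinner y y'"
  for x x' :: "'a::hilbert_fd" and y y' :: "'b::hilbert_fd"
proof -
  define E where "E = (SOME E :: 'a set. onb E)"
  have E: "onb E" unfolding E_def by (rule someI_ex[OF onb_exists])
  have "cinner (x \<otimes> y) (x' \<otimes> y') = (\<Sum>e\<in>E. (cinner x e * cinner e x') * cinner y y')"
    unfolding cinner_tensor_def E_def[symmetric]
    by (intro sum.cong refl)
      (simp add: pure.rep_eq cinner_scaleC_left cinner_scaleC_right cinner_commute[symmetric]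
        mult.assoc mult.left_commute)
  also have "\<dots> = cinner x (\<Sum>e\<in>E. cinner e x' *\<^sub>C e) * cinner y y'"
    by (simp add: cinner_sum_right cinner_scaleC_right sum_distrib_right mult.commute[of "cinner x _"])
  finally show ?thesis by (simp add: onb_expand[OF E])
qed

definition cbilinear :: "('a::complex_vector \<Rightarrow> 'b::complex_vector \<Rightarrow> 'c::complex_vector) \<Rightarrow> bool"
  where "cbilinear b \<longleftrightarrow> (\<forall>x. clinear (b x)) \<and> (\<forall>y. clinear (\<lambda>x. b x y))"

lemma tensor_ext:
  fixes f g :: "'a::hilbert_fd \<otimes> 'b::hilbert_fd \<Rightarrow> 'c::complex_vector"
  assumes "clinear f" "clinear g" "\<And>x y. f (x \<otimes> y) = g (x \<otimes> y)"
  shows "f = g"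
proof
  fix t
  obtain E :: "'a set" where E: "onb E" using onb_exists by blast
  show "f t = g t"
    by (subst (1 2) onb_tensor_expand[OF E, symmetric]) (simp add: clinear_sum assms)
qed

theorem tensor_universal:
  fixes b :: "'a::hilbert_fd \<Rightarrow> 'b::hilbert_fd \<Rightarrow> 'c::complex_vector"
  assumes "cbilinear b"
  shows "\<exists>!h. clinear h \<and> (\<forall>x y. h (x \<otimes> y) = b x y)"
proof (rule ex_ex1I)
  obtain E :: "'a set" where E: "onb E" using onb_exists by blast
  have b1: "clinear (b x)" and b2: "clinear (\<lambda>x. b x y)" for x y
    using assms by (auto simp: cbilinear_def)
  define h where "h t = (\<Sum>e\<in>E. b e (Rep_tensor t e))" for t :: "'a \<otimes> 'b"
  have "clinear h"
    by (rule clinearI)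
      (simp_all add: h_def plus_tensor.rep_eq scaleC_tensor.rep_eq clinear_add[OF b1]
        clinear_scale[OF b1] sum.distrib cvec.scale_sum_right)
  moreover have "h (x \<otimes> y) = b x y" for x y
  proof -
    have "h (x \<otimes> y) = (\<Sum>e\<in>E. b (cinner e x *\<^sub>C e) y)"
      by (simp add: h_def pure.rep_eq clinear_scale[OF b1] clinear_scale[OF b2])
    also have "\<dots> = b (\<Sum>e\<in>E. cinner e x *\<^sub>C e) y" by (simp add: clinear_sum[OF b2])
    finally show ?thesis by (simp add: onb_expand[OF E])
  qed
  ultimately show "\<exists>h. clinear h \<and> (\<forall>x y. h (x \<otimes> y) = b x y)" by blast
qed (auto intro: tensor_ext)

text \<open>The linear map out of the tensor product induced by a bilinear map.\<close>

definition tensor_lift ::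
    "('a::hilbert_fd \<Rightarrow> 'b::hilbert_fd \<Rightarrow> 'c::complex_vector) \<Rightarrow> 'a \<otimes> 'b \<Rightarrow> 'c"
  where "tensor_lift b = (THE h. clinear h \<and> (\<forall>x y. h (x \<otimes> y) = b x y))"

lemma
  assumes "cbilinear b"
  shows clinear_tensor_lift: "clinear (tensor_lift b)"
    and tensor_lift_pure: "tensor_lift b (x \<otimes> y) = b x y"
  using theI'[OF tensor_universal[OF assms]] by (auto simp: tensor_lift_def)


section \<open>Monoidal structure\<close>

definition tensor_map :: "('a::hilbert_fd \<Rightarrow> 'c::hilbert_fd) \<Rightarrow> ('b::hilbert_fd \<Rightarrow> 'd::hilbert_fd) \<Rightarrow>
    'a \<otimes> 'b \<Rightarrow> 'c \<otimes> 'd" (infixr "\<otimes>\<^sub>m" 76)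
  where "f \<otimes>\<^sub>m g = tensor_lift (\<lambda>x y. f x \<otimes> g y)"

definition assoc :: "('a::hilbert_fd \<otimes> 'b::hilbert_fd) \<otimes> 'c::hilbert_fd \<Rightarrow> 'a \<otimes> ('b \<otimes> 'c)"
  where "assoc = tensor_lift (\<lambda>t z. tensor_lift (\<lambda>x y. x \<otimes> (y \<otimes> z)) t)"

definition assoc_inv :: "'a::hilbert_fd \<otimes> ('b::hilbert_fd \<otimes> 'c::hilbert_fd) \<Rightarrow> ('a \<otimes> 'b) \<otimes> 'c"
  where "assoc_inv = tensor_lift (\<lambda>x. tensor_lift (\<lambda>y z. (x \<otimes> y) \<otimes> z))"

definition lunit :: "complex \<otimes> 'a::hilbert_fd \<Rightarrow> 'a"
  where "lunit = tensor_lift (\<lambda>c x. c *\<^sub>C x)"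

definition runit :: "'a::hilbert_fd \<otimes> complex \<Rightarrow> 'a"
  where "runit = tensor_lift (\<lambda>x c. c *\<^sub>C x)"

definition runit_inv :: "'a::hilbert_fd \<Rightarrow> 'a \<otimes> complex"
  where "runit_inv x = x \<otimes> 1"

lemma
  assumes f: "clinear f" and g: "clinear g"
  shows clinear_tensor_map: "clinear (f \<otimes>\<^sub>m g)"
    and tensor_map_pure: "(f \<otimes>\<^sub>m g) (x \<otimes> y) = f x \<otimes> g y"
proof -
  have "cbilinear (\<lambda>x y. f x \<otimes> g y)"
    unfolding cbilinear_def
    by (auto intro!: clinearI simp: clinear_add[OF f] clinear_add[OF g] clinear_scale[OF f]
        clinear_scale[OF g] pure_add_left pure_add_right pure_scale_left pure_scale_right)
  then show "clinear (f \<otimes>\<^sub>m g)" "(f \<otimes>\<^sub>m g) (x \<otimes> y) = f x \<otimes> g y"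
    by (simp_all add: tensor_map_def clinear_tensor_lift tensor_lift_pure)
qed

lemma clinear_plus: "clinear f \<Longrightarrow> clinear g \<Longrightarrow> clinear (\<lambda>x. f x + g x)"
  by (rule clinearI) (simp_all add: clinear_add clinear_scale scaleC_add_right)

lemma clinear_scaleC: "clinear f \<Longrightarrow> clinear (\<lambda>x. c *\<^sub>C f x)"
  by (rule clinearI) (simp_all add: clinear_add clinear_scale scaleC_add_right scaleC_scaleC mult.commute)

lemma cbilinear_lift_param:
  fixes b :: "'p::complex_vector \<Rightarrow> 'a::hilbert_fd \<Rightarrow> 'b::hilbert_fd \<Rightarrow> 'c::complex_vector"
  assumes b: "\<And>z. cbilinear (b z)" and p: "\<And>x y. clinear (\<lambda>z. b z x y)"
  shows "clinear (\<lambda>z. tensor_lift (b z) t)"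
proof (rule clinearI)
  have "tensor_lift (b (z + w)) = (\<lambda>t. tensor_lift (b z) t + tensor_lift (b w) t)" for z w
    by (rule tensor_ext)
      (simp_all add: clinear_plus clinear_tensor_lift b tensor_lift_pure clinear_add[OF p])
  then show "tensor_lift (b (z + w)) t = tensor_lift (b z) t + tensor_lift (b w) t" for z w by metis
  have "tensor_lift (b (c *\<^sub>C z)) = (\<lambda>t. c *\<^sub>C tensor_lift (b z) t)" for c z
    by (rule tensor_ext)
      (simp_all add: clinear_scaleC clinear_tensor_lift b tensor_lift_pure clinear_scale[OF p])
  then show "tensor_lift (b (c *\<^sub>C z)) t = c *\<^sub>C tensor_lift (b z) t" for c z by metis
qed

lemmas pure_simps = pure_add_left pure_add_right pure_scale_left pure_scale_right

lemma
  fixes x :: "'a::hilbert_fd" and y :: "'b::hilbert_fd" and z :: "'c::hilbert_fd"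
  shows clinear_assoc:
      "clinear (assoc :: ('a \<otimes> 'b) \<otimes> 'c \<Rightarrow> 'a \<otimes> 'b \<otimes> 'c)"
    and assoc_pure: "assoc ((x \<otimes> y) \<otimes> z) = x \<otimes> (y \<otimes> z)"
proof -
  have 1: "cbilinear (\<lambda>x y. x \<otimes> (y \<otimes> z))" for z :: 'c
    unfolding cbilinear_def by (auto intro!: clinearI simp: pure_simps)
  have 2: "clinear (\<lambda>z. x \<otimes> (y \<otimes> z))" for x :: 'a and y :: 'b
    by (auto intro!: clinearI simp: pure_simps)
  have 3: "cbilinear (\<lambda>t z. tensor_lift (\<lambda>(x::'a) (y::'b). x \<otimes> (y \<otimes> (z::'c))) t)"
    unfolding cbilinear_def using clinear_tensor_lift[OF 1] cbilinear_lift_param[OF 1 2] by auto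
  show "clinear (assoc :: ('a \<otimes> 'b) \<otimes> 'c \<Rightarrow> _)"
    unfolding assoc_def by (rule clinear_tensor_lift[OF 3])
  show "assoc ((x \<otimes> y) \<otimes> z) = x \<otimes> (y \<otimes> z)"
    unfolding assoc_def by (simp add: tensor_lift_pure[OF 3] tensor_lift_pure[OF 1])
qed

lemma
  fixes x :: "'a::hilbert_fd" and y :: "'b::hilbert_fd" and z :: "'c::hilbert_fd"
  shows clinear_assoc_inv:
      "clinear (assoc_inv :: 'a \<otimes> 'b \<otimes> 'c \<Rightarrow> ('a \<otimes> 'b) \<otimes> 'c)"
    and assoc_inv_pure: "assoc_inv (x \<otimes> (y \<otimes> z)) = (x \<otimes> y) \<otimes> z"
proof -
  have 1: "cbilinear (\<lambda>y z. (x \<otimes> y) \<otimes> z)" for x :: 'a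
    unfolding cbilinear_def by (auto intro!: clinearI simp: pure_simps)
  have 2: "clinear (\<lambda>x. (x \<otimes> y) \<otimes> z)" for y :: 'b and z :: 'c
    by (auto intro!: clinearI simp: pure_simps)
  have 3: "cbilinear (\<lambda>x. tensor_lift (\<lambda>y z. ((x::'a) \<otimes> (y::'b)) \<otimes> (z::'c)))"
    unfolding cbilinear_def using clinear_tensor_lift[OF 1] cbilinear_lift_param[OF 1 2] by auto
  show "clinear (assoc_inv :: 'a \<otimes> 'b \<otimes> 'c \<Rightarrow> _)"
    unfolding assoc_inv_def by (rule clinear_tensor_lift[OF 3])
  show "assoc_inv (x \<otimes> (y \<otimes> z)) = (x \<otimes> y) \<otimes> z"
    unfolding assoc_inv_def by (simp add: tensor_lift_pure[OF 3] tensor_lift_pure[OF 1])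
qed

lemma
  shows clinear_lunit: "clinear (lunit :: complex \<otimes> 'a::hilbert_fd \<Rightarrow> 'a)"
    and lunit_pure: "lunit (c \<otimes> x) = c *\<^sub>C (x :: 'a)"
proof -
  have 1: "cbilinear (\<lambda>c x. c *\<^sub>C (x :: 'a))"
    unfolding cbilinear_def
    by (auto intro!: clinearI
        simp: scaleC_add_left scaleC_add_right scaleC_scaleC scaleC_complex_def mult.commute)
  show "clinear (lunit :: complex \<otimes> 'a \<Rightarrow> 'a)" "lunit (c \<otimes> x) = c *\<^sub>C (x :: 'a)"
    unfolding lunit_def by (rule clinear_tensor_lift[OF 1], simp add: tensor_lift_pure[OF 1])
qed

lemma
  shows clinear_runit: "clinear (runit :: 'a::hilbert_fd \<otimes> complex \<Rightarrow> 'a)"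
    and runit_pure: "runit (x \<otimes> c) = c *\<^sub>C (x :: 'a)"
proof -
  have 1: "cbilinear (\<lambda>x c. c *\<^sub>C (x :: 'a))"
    unfolding cbilinear_def
    by (auto intro!: clinearI
        simp: scaleC_add_left scaleC_add_right scaleC_scaleC scaleC_complex_def mult.commute)
  show "clinear (runit :: 'a \<otimes> complex \<Rightarrow> 'a)" "runit (x \<otimes> c) = c *\<^sub>C (x :: 'a)"
    unfolding runit_def by (rule clinear_tensor_lift[OF 1], simp add: tensor_lift_pure[OF 1])
qed

lemma runit_runit_inv: "runit (runit_inv x) = x"
  by (simp add: runit_inv_def runit_pure scaleC_one)

lemma clinear_runit_inv: "clinear runit_inv"
  unfolding runit_inv_def by (rule clinear_pure_left)

lemma runit_inv_runit: "runit_inv (runit t) = (t :: 'a::hilbert_fd \<otimes> complex)"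
proof -
  have "(c *\<^sub>C x) \<otimes> 1 = x \<otimes> (c *\<^sub>C (1 :: complex))" for c and x :: 'a
    by (simp only: pure_scale_left pure_scale_right)
  then have "runit_inv \<circ> runit = (id :: 'a \<otimes> complex \<Rightarrow> 'a \<otimes> complex)"
    by (intro tensor_ext clinear_id clinear_comp clinear_runit clinear_runit_inv)
      (simp add: runit_inv_def runit_pure scaleC_complex_def)
  then show ?thesis by (metis comp_apply id_apply)
qed


section \<open>Q-systems, quantum bi-elements and non-unital quantum functions\<close>

text \<open>The associators and unitors left implicit when the monoidal category is treated as strict
  are written out.\<close>

definition qsystem :: "('a \<otimes> 'a \<Rightarrow> 'a::hilbert_fd) \<Rightarrow> (complex \<Rightarrow> 'a) \<Rightarrow> bool"
  where "qsystem m i \<longleftrightarrow> clinear m \<and> clinear i \<and>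
    m \<circ> (m \<otimes>\<^sub>m id) = m \<circ> (id \<otimes>\<^sub>m m) \<circ> assoc \<and>
    m \<circ> (i \<otimes>\<^sub>m id) = lunit \<and>
    m \<circ> (id \<otimes>\<^sub>m i) = runit \<and>
    (m \<otimes>\<^sub>m id) \<circ> assoc_inv \<circ> (id \<otimes>\<^sub>m m\<^sup>\<dagger>) = m\<^sup>\<dagger> \<circ> m \<and>
    (id \<otimes>\<^sub>m m) \<circ> assoc \<circ> (m\<^sup>\<dagger> \<otimes>\<^sub>m id) = m\<^sup>\<dagger> \<circ> m \<and>
    m \<circ> m\<^sup>\<dagger> = id"

definition quantum_bielement ::
    "('a \<otimes> 'a \<Rightarrow> 'a::hilbert_fd) \<Rightarrow> (complex \<Rightarrow> 'a) \<Rightarrow>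
     ('b \<otimes> 'b \<Rightarrow> 'b::hilbert_fd) \<Rightarrow> (complex \<Rightarrow> 'b) \<Rightarrow>
     ('h::hilbert_fd \<Rightarrow> 'a \<otimes> 'h) \<Rightarrow> ('h \<Rightarrow> 'h \<otimes> 'b) \<Rightarrow> bool"
  where "quantum_bielement mA iA mB iB Q1 Q2 \<longleftrightarrow> clinear Q1 \<and> clinear Q2 \<and>
    (id \<otimes>\<^sub>m Q1) \<circ> Q1 = assoc \<circ> (mA\<^sup>\<dagger> \<otimes>\<^sub>m id) \<circ> Q1 \<and>
    assoc \<circ> (Q2 \<otimes>\<^sub>m id) \<circ> Q2 = (id \<otimes>\<^sub>m mB\<^sup>\<dagger>) \<circ> Q2 \<and>
    (id \<otimes>\<^sub>m Q2) \<circ> Q1 = assoc \<circ> (Q1 \<otimes>\<^sub>m id) \<circ> Q2 \<and>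
    lunit \<circ> (iA\<^sup>\<dagger> \<otimes>\<^sub>m id) \<circ> Q1 = id \<and>
    runit \<circ> (id \<otimes>\<^sub>m iB\<^sup>\<dagger>) \<circ> Q2 = id \<and>
    Q1\<^sup>\<dagger> = lunit \<circ> ((iA\<^sup>\<dagger> \<circ> mA) \<otimes>\<^sub>m id) \<circ> assoc_inv \<circ> (id \<otimes>\<^sub>m Q1) \<and>
    Q2\<^sup>\<dagger> = runit \<circ> (id \<otimes>\<^sub>m (iB\<^sup>\<dagger> \<circ> mB)) \<circ> assoc \<circ> (Q2 \<otimes>\<^sub>m id)"

text \<open>In the last condition the successive intermediate spaces, starting from \<open>A \<otimes> H\<close>, are
  \<open>(A \<otimes> H) \<otimes> \<complex>\<close>, \<open>(A \<otimes> H) \<otimes> (B \<otimes> B)\<close>, \<open>((A \<otimes> H) \<otimes> B) \<otimes> B\<close>, \<open>(A \<otimes> (H \<otimes> B)) \<otimes> B\<close>,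
  \<open>(A \<otimes> (A \<otimes> H)) \<otimes> B\<close>, \<open>((A \<otimes> A) \<otimes> H) \<otimes> B\<close>, \<open>(A \<otimes> A) \<otimes> (H \<otimes> B)\<close>, \<open>\<complex> \<otimes> (H \<otimes> B)\<close>,
  \<open>H \<otimes> B\<close>.\<close>

definition nonunital_quantum_function ::
    "('b \<otimes> 'b \<Rightarrow> 'b::hilbert_fd) \<Rightarrow> (complex \<Rightarrow> 'b) \<Rightarrow>
     ('a \<otimes> 'a \<Rightarrow> 'a::hilbert_fd) \<Rightarrow> (complex \<Rightarrow> 'a) \<Rightarrow>
     ('h::hilbert_fd \<otimes> 'b \<Rightarrow> 'a \<otimes> 'h) \<Rightarrow> bool"
  where "nonunital_quantum_function mB iB mA iA P \<longleftrightarrow> clinear P \<and>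
    (mA\<^sup>\<dagger> \<otimes>\<^sub>m id) \<circ> P =
      assoc_inv \<circ> (id \<otimes>\<^sub>m P) \<circ> assoc \<circ> (P \<otimes>\<^sub>m id) \<circ> assoc_inv \<circ> (id \<otimes>\<^sub>m mB\<^sup>\<dagger>) \<and>
    P\<^sup>\<dagger> =
      lunit \<circ> ((iA\<^sup>\<dagger> \<circ> mA) \<otimes>\<^sub>m id) \<circ> assoc \<circ> (assoc_inv \<otimes>\<^sub>m id) \<circ> ((id \<otimes>\<^sub>m P) \<otimes>\<^sub>m id)
        \<circ> (assoc \<otimes>\<^sub>m id) \<circ> assoc_inv \<circ> (id \<otimes>\<^sub>m (mB\<^sup>\<dagger> \<circ> iB)) \<circ> runit_inv"

end

theory Submission
  imports Defs
begin

text \<open>Both identities rest on \<open>(1 \<otimes> Q2\<^sup>\<dagger>) (Q1 \<otimes> 1) = Q1 Q2\<^sup>\<dagger>\<close>: the reality condition writes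
  \<open>Q2\<^sup>\<dagger>\<close> in terms of \<open>Q2\<close>, which commutes with \<open>Q1\<close>.  Multiplicativity of \<open>P = Q1 Q2\<^sup>\<dagger>\<close> then follows
  from coassociativity of \<open>Q1\<close>, the adjoint of coassociativity of \<open>Q2\<close>, and separability.  For the
  reality of \<open>P\<close>, the right-hand side collapses to \<open>(Q1\<^sup>\<dagger> \<otimes> 1) (1 \<otimes> Q2)\<close> by the reality of \<open>Q1\<close> and
  the adjoint of the reality of \<open>Q2\<close>; this is the adjoint of \<open>(1 \<otimes> Q2\<^sup>\<dagger>) (Q1 \<otimes> 1)\<close>.\<close>

section \<open>Adjoints of linear maps\<close>

lemma adj_eqI:
  fixes f :: "'a::hilbert_fd \<Rightarrow> 'b::hilbert_fd"
  assumes "clinear f" and "\<And>y x. cinner (g y) x = cinner y (f x)"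
  shows "f\<^sup>\<dagger> = g"
proof (rule ext, rule cinner_eqI)
  fix y z
  have "cinner (f\<^sup>\<dagger> y) z = cinner (g y) z" by (simp add: cinner_adj assms)
  then show "cinner z (f\<^sup>\<dagger> y) = cinner z (g y)"
    using cinner_commute[of z "f\<^sup>\<dagger> y"] cinner_commute[of z "g y"] by simp
qed

lemma cinner_adj_right:
  fixes f :: "'a::hilbert_fd \<Rightarrow> 'b::hilbert_fd"
  assumes "clinear f"
  shows "cinner x (f\<^sup>\<dagger> y) = cinner (f x) y"
  using cinner_adj[OF assms, of y x] cinner_commute[of x "f\<^sup>\<dagger> y"] cinner_commute[of "f x" y] by simp

lemma clinear_adj:
  fixes f :: "'a::hilbert_fd \<Rightarrow> 'b::hilbert_fd"
  assumes "clinear f"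
  shows "clinear (f\<^sup>\<dagger>)"
  by (rule clinearI; rule cinner_eqI)
    (simp_all add: cinner_adj_right assms cinner_add_right cinner_scaleC_right)

lemmas clinear_rules = clinear_id clinear_comp clinear_adj clinear_tensor_map
  clinear_assoc clinear_assoc_inv clinear_lunit clinear_runit clinear_runit_inv

lemma adj_adj:
  fixes f :: "'a::hilbert_fd \<Rightarrow> 'b::hilbert_fd"
  assumes "clinear f"
  shows "(f\<^sup>\<dagger>)\<^sup>\<dagger> = f"
  by (rule adj_eqI) (simp_all add: clinear_adj cinner_adj_right assms)

lemma adj_id: "(id :: 'a::hilbert_fd \<Rightarrow> 'a)\<^sup>\<dagger> = id"
  by (rule adj_eqI) (simp_all add: clinear_id)

lemma adj_comp:
  fixes f :: "'a::hilbert_fd \<Rightarrow> 'b::hilbert_fd" and g :: "'b \<Rightarrow> 'c::hilbert_fd"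
  assumes "clinear f" "clinear g"
  shows "(g \<circ> f)\<^sup>\<dagger> = f\<^sup>\<dagger> \<circ> g\<^sup>\<dagger>"
  by (rule adj_eqI) (simp_all add: clinear_comp cinner_adj assms)

lemma clinear_cinner: "clinear f \<Longrightarrow> clinear (\<lambda>t. cinner s (f t))"
  by (rule clinearI)
    (simp_all add: clinear_add clinear_scale cinner_add_right cinner_scaleC_right scaleC_complex_def)

lemma clinear_cinner_id: "clinear (cinner s)"
  using clinear_cinner[OF clinear_id, of s] by simp

text \<open>Reduces the adjoint relation to pure tensors. The inner product is linear only in its
  second argument, so the tensor argument is moved there by conjugate symmetry before
  \<open>tensor_ext\<close> applies.\<close>

lemma adj_eqI_tensor:
  fixes f :: "'a::hilbert_fd \<otimes> 'b::hilbert_fd \<Rightarrow> 'c::hilbert_fd"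
  assumes f: "clinear f"
    and "\<And>x y z. cinner (x \<otimes> y) (g z) = cinner (f (x \<otimes> y)) z"
  shows "f\<^sup>\<dagger> = g"
proof (rule adj_eqI[OF f])
  fix z t
  have "cinner (g z) = (\<lambda>t. cinner z (f t))"
  proof (rule tensor_ext[OF clinear_cinner_id clinear_cinner[OF f]])
    show "cinner (g z) (x \<otimes> y) = cinner z (f (x \<otimes> y))" for x y
      using assms(2)[of x y z] by (metis cinner_commute)
  qed
  then show "cinner (g z) t = cinner z (f t)" by metis
qed

section \<open>Iterated tensor products: extensionality and adjoints\<close>

lemma tensor_ext_left:
  fixes f g :: "('a::hilbert_fd \<otimes> 'b::hilbert_fd) \<otimes> 'c::hilbert_fd \<Rightarrow> 'd::complex_vector"
  assumes "clinear f" "clinear g" and eq: "\<And>x y z. f ((x \<otimes> y) \<otimes> z) = g ((x \<otimes> y) \<otimes> z)"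
  shows "f = g"
proof (rule tensor_ext[OF assms(1,2)])
  fix t z
  \<comment> \<open>With \<open>z\<close> frozen both sides are linear in \<open>t\<close>, so
    \<open>tensor_ext\<close> applies a second time.\<close>
  have "f \<circ> (\<lambda>t. t \<otimes> z) = g \<circ> (\<lambda>t. t \<otimes> z)"
    by (rule tensor_ext) (simp_all add: assms clinear_comp[OF clinear_pure_left])
  then show "f (t \<otimes> z) = g (t \<otimes> z)" by (metis comp_apply)
qed

lemma tensor_ext_right:
  fixes f g :: "'a::hilbert_fd \<otimes> 'b::hilbert_fd \<otimes> 'c::hilbert_fd \<Rightarrow> 'd::complex_vector"
  assumes "clinear f" "clinear g" and eq: "\<And>x y z. f (x \<otimes> (y \<otimes> z)) = g (x \<otimes> (y \<otimes> z))"
  shows "f = g"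
proof (rule tensor_ext[OF assms(1,2)])
  fix x t
  have "f \<circ> (\<lambda>t. x \<otimes> t) = g \<circ> (\<lambda>t. x \<otimes> t)"
    by (rule tensor_ext) (simp_all add: assms clinear_comp[OF clinear_pure_right])
  then show "f (x \<otimes> t) = g (x \<otimes> t)" by (metis comp_apply)
qed

lemma tensor_ext_left_left:
  fixes f g :: "(('a::hilbert_fd \<otimes> 'b::hilbert_fd) \<otimes> 'c::hilbert_fd) \<otimes> 'd::hilbert_fd
    \<Rightarrow> 'e::complex_vector"
  assumes "clinear f" "clinear g"
    and eq: "\<And>x y z w. f (((x \<otimes> y) \<otimes> z) \<otimes> w) = g (((x \<otimes> y) \<otimes> z) \<otimes> w)"
  shows "f = g"
proof (rule tensor_ext[OF assms(1,2)])
  fix t w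
  have "f \<circ> (\<lambda>t. t \<otimes> w) = g \<circ> (\<lambda>t. t \<otimes> w)"
    by (rule tensor_ext_left) (simp_all add: assms clinear_comp[OF clinear_pure_left])
  then show "f (t \<otimes> w) = g (t \<otimes> w)" by (metis comp_apply)
qed

lemma adj_tensor_map:
  fixes f :: "'a::hilbert_fd \<Rightarrow> 'c::hilbert_fd" and g :: "'b::hilbert_fd \<Rightarrow> 'd::hilbert_fd"
  assumes f: "clinear f" and g: "clinear g"
  shows "(f \<otimes>\<^sub>m g)\<^sup>\<dagger> = f\<^sup>\<dagger> \<otimes>\<^sub>m g\<^sup>\<dagger>"
proof (rule adj_eqI_tensor)
  fix x y t
  \<comment> \<open>\<open>adj_eqI_tensor\<close> has made the input pure; a second extensionality
    argument does the same for \<open>t\<close>, after which \<open>cinner_pure\<close> splits both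
    sides into factors.\<close>
  have "(\<lambda>t. cinner (x \<otimes> y) ((f\<^sup>\<dagger> \<otimes>\<^sub>m g\<^sup>\<dagger>) t)) = cinner ((f \<otimes>\<^sub>m g) (x \<otimes> y))"
    by (rule tensor_ext)
      (simp_all add: clinear_cinner clinear_cinner_id clinear_rules f g tensor_map_pure cinner_pure
        cinner_adj_right)
  then show "cinner (x \<otimes> y) ((f\<^sup>\<dagger> \<otimes>\<^sub>m g\<^sup>\<dagger>) t) = cinner ((f \<otimes>\<^sub>m g) (x \<otimes> y)) t" by metis
qed (simp add: clinear_rules f g)

lemma adj_runit: "runit\<^sup>\<dagger> = (runit_inv :: 'a::hilbert_fd \<Rightarrow> _)"
  by (rule adj_eqI_tensor)
    (simp_all add: clinear_rules runit_pure runit_inv_def cinner_pure cinner_scaleC_left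
      cinner_complex_def)

text \<open>The associator is unitary. The relation is checked on pure tensors in one variable at a
  time, first \<open>t\<close> and then \<open>s\<close>, with a conjugation in between to bring
  \<open>s\<close> into the linear slot.\<close>

lemma adj_assoc:
  "(assoc :: ('a::hilbert_fd \<otimes> 'b::hilbert_fd) \<otimes> 'c::hilbert_fd \<Rightarrow> _)\<^sup>\<dagger> = assoc_inv"
proof (rule adj_eqI[OF clinear_assoc])
  fix t and s :: "('a \<otimes> 'b) \<otimes> 'c"
  have "cinner ((x \<otimes> y) \<otimes> z) (assoc_inv t) = cinner (x \<otimes> (y \<otimes> z)) t"
    for x :: 'a and y :: 'b and z :: 'c
  proof -
    have "(\<lambda>t. cinner ((x \<otimes> y) \<otimes> z) (assoc_inv t)) = cinner (x \<otimes> (y \<otimes> z))"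
      by (rule tensor_ext_right)
        (simp_all add: clinear_cinner clinear_cinner_id clinear_rules assoc_inv_pure cinner_pure)
    then show ?thesis by metis
  qed
  then have "cinner (assoc_inv t) ((x \<otimes> y) \<otimes> z) = cinner t (x \<otimes> (y \<otimes> z))"
    for x :: 'a and y :: 'b and z :: 'c
    by (metis cinner_commute)
  then have "cinner (assoc_inv t) = (\<lambda>s. cinner t (assoc s))"
    by (intro tensor_ext_left)
      (simp_all add: clinear_cinner clinear_cinner_id clinear_rules assoc_pure)
  then show "cinner (assoc_inv t) s = cinner t (assoc s)" by metis
qed

section \<open>Functoriality, naturality and coherence of the monoidal structure\<close>

lemma tensor_map_comp:
  assumes "clinear f" "clinear g" "clinear h" "clinear k"
  shows "(f \<otimes>\<^sub>m g) \<circ> (h \<otimes>\<^sub>m k) = (f \<circ> h) \<otimes>\<^sub>m (g \<circ> k)"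
  by (rule tensor_ext) (simp_all add: clinear_rules assms tensor_map_pure)

lemma tensor_map_id: "id \<otimes>\<^sub>m id = id"
  by (rule tensor_ext) (simp_all add: clinear_rules tensor_map_pure)

lemma assoc_natural:
  assumes "clinear f" "clinear g" "clinear h"
  shows "assoc \<circ> ((f \<otimes>\<^sub>m g) \<otimes>\<^sub>m h) = (f \<otimes>\<^sub>m (g \<otimes>\<^sub>m h)) \<circ> assoc"
  by (rule tensor_ext_left) (simp_all add: clinear_rules assms tensor_map_pure assoc_pure)

lemma assoc_inv_natural:
  assumes "clinear f" "clinear g" "clinear h"
  shows "assoc_inv \<circ> (f \<otimes>\<^sub>m (g \<otimes>\<^sub>m h)) = ((f \<otimes>\<^sub>m g) \<otimes>\<^sub>m h) \<circ> assoc_inv"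
  by (rule tensor_ext_right) (simp_all add: clinear_rules assms tensor_map_pure assoc_inv_pure)

lemma assoc_assoc_inv: "assoc \<circ> assoc_inv = id"
  by (rule tensor_ext_right) (simp_all add: clinear_rules assoc_pure assoc_inv_pure)

lemma assoc_inv_assoc: "assoc_inv \<circ> assoc = id"
  by (rule tensor_ext_left) (simp_all add: clinear_rules assoc_pure assoc_inv_pure)

lemma pentagon: "(id \<otimes>\<^sub>m assoc) \<circ> assoc \<circ> (assoc \<otimes>\<^sub>m id) = assoc \<circ> assoc"
  by (rule tensor_ext_left_left) (simp_all add: clinear_rules tensor_map_pure assoc_pure)

text \<open>The pentagon in the form that arises in the reality condition on \<open>P\<close>: it
  lets a pair of copies of \<open>B\<close> be reassociated inside the right factor of
  \<open>A \<otimes> _\<close>. The proof precomposes with \<open>assoc\<close> so that all maps act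
  on left-nested pure tensors.\<close>

lemma pentagon_inv: "(assoc \<otimes>\<^sub>m id) \<circ> assoc_inv = assoc_inv \<circ> (id \<otimes>\<^sub>m assoc_inv) \<circ> assoc"
  (is "?l \<circ> _ = ?r \<circ> _")
proof -
  have "?l = ?r \<circ> assoc \<circ> assoc"
    by (rule tensor_ext_left_left)
      (simp_all add: clinear_rules tensor_map_pure assoc_pure assoc_inv_pure)
  then show ?thesis by (simp add: comp_assoc assoc_assoc_inv)
qed

lemma assoc_runit: "(id \<otimes>\<^sub>m runit) \<circ> assoc = runit"
  by (rule tensor_ext_left)
    (simp_all add: clinear_rules tensor_map_pure assoc_pure runit_pure pure_scale_right)

lemma runit_natural: "clinear f \<Longrightarrow> runit \<circ> (f \<otimes>\<^sub>m id) = f \<circ> runit"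
  by (rule tensor_ext) (simp_all add: clinear_rules tensor_map_pure runit_pure clinear_scale)

lemma assoc_runit_inv: "assoc \<circ> runit_inv = id \<otimes>\<^sub>m runit_inv"
  by (rule tensor_ext) (simp_all add: clinear_rules tensor_map_pure assoc_pure runit_inv_def)

lemma lunit_assoc: "lunit \<circ> assoc = lunit \<otimes>\<^sub>m id"
  by (rule tensor_ext_left)
    (simp_all add: clinear_rules tensor_map_pure assoc_pure lunit_pure pure_scale_left)

section \<open>Sliding the two coactions past each other, and the theorem\<close>

text \<open>Here \<open>\<epsilon>\<close> stands for \<open>iB\<^sup>\<dagger> \<circ> mB\<close>.
  It contracts the two copies of \<open>B\<close> while \<open>Q1\<close> touches only
  \<open>H\<close>, so after \<open>commute\<close> has exchanged \<open>Q1\<close> and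
  \<open>Q2\<close> the remaining work is associator bookkeeping.\<close>

lemma coaction_adj_commute:
  fixes Q1 :: "'h::hilbert_fd \<Rightarrow> 'a::hilbert_fd \<otimes> 'h" and Q2 :: "'h \<Rightarrow> 'h \<otimes> 'b::hilbert_fd"
    and \<epsilon> :: "'b \<otimes> 'b \<Rightarrow> complex"
  assumes Q1: "clinear Q1" and Q2: "clinear Q2" and \<epsilon>: "clinear \<epsilon>"
    and commute: "(id \<otimes>\<^sub>m Q2) \<circ> Q1 = assoc \<circ> (Q1 \<otimes>\<^sub>m id) \<circ> Q2"
    and real: "Q2\<^sup>\<dagger> = runit \<circ> (id \<otimes>\<^sub>m \<epsilon>) \<circ> assoc \<circ> (Q2 \<otimes>\<^sub>m id)"
  shows "(id \<otimes>\<^sub>m Q2\<^sup>\<dagger>) \<circ> assoc \<circ> (Q1 \<otimes>\<^sub>m id) = Q1 \<circ> Q2\<^sup>\<dagger>"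
proof -
  note [simp] = clinear_rules Q1 Q2 \<epsilon>
  have "(id \<otimes>\<^sub>m Q2\<^sup>\<dagger>) \<circ> assoc \<circ> (Q1 \<otimes>\<^sub>m id)
    = (id \<otimes>\<^sub>m runit) \<circ> (id \<otimes>\<^sub>m (id \<otimes>\<^sub>m \<epsilon>)) \<circ> (id \<otimes>\<^sub>m assoc)
      \<circ> ((id \<otimes>\<^sub>m (Q2 \<otimes>\<^sub>m id)) \<circ> assoc) \<circ> (Q1 \<otimes>\<^sub>m id)"
    by (simp add: real tensor_map_comp comp_assoc[symmetric])
  also have "\<dots> = (id \<otimes>\<^sub>m runit) \<circ> (id \<otimes>\<^sub>m (id \<otimes>\<^sub>m \<epsilon>)) \<circ> (id \<otimes>\<^sub>m assoc)
      \<circ> assoc \<circ> (((id \<otimes>\<^sub>m Q2) \<otimes>\<^sub>m id) \<circ> (Q1 \<otimes>\<^sub>m id))"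
    by (simp add: assoc_natural[symmetric] comp_assoc)
  \<comment> \<open>The two coactions are exchanged here, with an inert factor \<open>B\<close> on
    the right.\<close>
  also have "((id \<otimes>\<^sub>m Q2) \<otimes>\<^sub>m id) \<circ> (Q1 \<otimes>\<^sub>m id) =
      (assoc \<otimes>\<^sub>m id) \<circ> ((Q1 \<otimes>\<^sub>m id) \<otimes>\<^sub>m id) \<circ> (Q2 \<otimes>\<^sub>m (id :: 'b \<Rightarrow> 'b))"
    by (simp add: tensor_map_comp commute)
  also have "(id \<otimes>\<^sub>m runit) \<circ> (id \<otimes>\<^sub>m (id \<otimes>\<^sub>m \<epsilon>)) \<circ> (id \<otimes>\<^sub>m assoc) \<circ> assoc \<circ> \<dots>
    = (id \<otimes>\<^sub>m runit) \<circ> (id \<otimes>\<^sub>m (id \<otimes>\<^sub>m \<epsilon>)) \<circ> ((id \<otimes>\<^sub>m assoc) \<circ> assoc \<circ> (assoc \<otimes>\<^sub>m id))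
      \<circ> ((Q1 \<otimes>\<^sub>m id) \<otimes>\<^sub>m id) \<circ> (Q2 \<otimes>\<^sub>m id)"
    by (simp only: comp_assoc)
  also have "\<dots> = (id \<otimes>\<^sub>m runit) \<circ> ((id \<otimes>\<^sub>m (id \<otimes>\<^sub>m \<epsilon>)) \<circ> assoc)
      \<circ> (assoc \<circ> ((Q1 \<otimes>\<^sub>m id) \<otimes>\<^sub>m id)) \<circ> (Q2 \<otimes>\<^sub>m id)"
    by (simp only: pentagon) (simp only: comp_assoc)
  \<comment> \<open>Each of the two associators from the pentagon is used once: one lets
    \<open>\<epsilon>\<close> pass, the other \<open>Q1\<close>, which makes these two maps
    adjacent.\<close>
  also have "\<dots> = ((id \<otimes>\<^sub>m runit) \<circ> assoc) \<circ> ((id \<otimes>\<^sub>m \<epsilon>) \<circ> (Q1 \<otimes>\<^sub>m id)) \<circ> assoc \<circ> (Q2 \<otimes>\<^sub>m id)"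
    by (simp add: assoc_natural assoc_natural[symmetric, of id id] tensor_map_id comp_assoc)
  \<comment> \<open>By interchange \<open>\<epsilon>\<close> and \<open>Q1\<close> commute;
    naturality of \<open>runit\<close> then pulls \<open>Q1\<close> out in front, and what remains
    is \<open>real\<close>.\<close>
  also have "\<dots> = (runit \<circ> (Q1 \<otimes>\<^sub>m id)) \<circ> (id \<otimes>\<^sub>m \<epsilon>) \<circ> assoc \<circ> (Q2 \<otimes>\<^sub>m id)"
    by (simp only: assoc_runit comp_assoc) (simp add: tensor_map_comp comp_assoc[symmetric])
  also have "\<dots> = Q1 \<circ> Q2\<^sup>\<dagger>"
    by (simp add: runit_natural real comp_assoc)
  finally show ?thesis .
qed

theorem proposition1p2:
  fixes mA :: "'a::hilbert_fd \<otimes> 'a \<Rightarrow> 'a" and iA :: "complex \<Rightarrow> 'a"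
    and mB :: "'b::hilbert_fd \<otimes> 'b \<Rightarrow> 'b" and iB :: "complex \<Rightarrow> 'b"
    and Q1 :: "'h::hilbert_fd \<Rightarrow> 'a \<otimes> 'h" and Q2 :: "'h \<Rightarrow> 'h \<otimes> 'b"
  assumes "qsystem mA iA" and "qsystem mB iB"
    and "quantum_bielement mA iA mB iB Q1 Q2"
  shows "nonunital_quantum_function mB iB mA iA (Q1 \<circ> Q2\<^sup>\<dagger>)"
proof -
  have [simp]: "clinear mA" "clinear iA" "clinear mB" "clinear iB" "clinear Q1" "clinear Q2"
    and sep: "mB \<circ> mB\<^sup>\<dagger> = id"
    and Q1_coassoc: "(id \<otimes>\<^sub>m Q1) \<circ> Q1 = assoc \<circ> (mA\<^sup>\<dagger> \<otimes>\<^sub>m id) \<circ> Q1"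
    and Q2_coassoc: "assoc \<circ> (Q2 \<otimes>\<^sub>m id) \<circ> Q2 = (id \<otimes>\<^sub>m mB\<^sup>\<dagger>) \<circ> Q2"
    and commute: "(id \<otimes>\<^sub>m Q2) \<circ> Q1 = assoc \<circ> (Q1 \<otimes>\<^sub>m id) \<circ> Q2"
    and Q1_real: "Q1\<^sup>\<dagger> = lunit \<circ> ((iA\<^sup>\<dagger> \<circ> mA) \<otimes>\<^sub>m id) \<circ> assoc_inv \<circ> (id \<otimes>\<^sub>m Q1)"
    and Q2_real: "Q2\<^sup>\<dagger> = runit \<circ> (id \<otimes>\<^sub>m (iB\<^sup>\<dagger> \<circ> mB)) \<circ> assoc \<circ> (Q2 \<otimes>\<^sub>m id)"
    using assms unfolding qsystem_def quantum_bielement_def by blast+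
  note [simp] = clinear_rules
  define P where "P = Q1 \<circ> Q2\<^sup>\<dagger>"
  have P: "clinear P" by (simp add: P_def)
  have slide: "(id \<otimes>\<^sub>m Q2\<^sup>\<dagger>) \<circ> assoc \<circ> (Q1 \<otimes>\<^sub>m id) = P"
    unfolding P_def by (rule coaction_adj_commute[OF _ _ _ commute Q2_real]) simp_all

  \<comment> \<open>The adjoint of coassociativity says that \<open>Q2\<^sup>\<dagger>\<close> is an
    associative right action of \<open>B\<close> on \<open>H\<close>.\<close>
  have "(assoc \<circ> (Q2 \<otimes>\<^sub>m id) \<circ> Q2)\<^sup>\<dagger> = ((id \<otimes>\<^sub>m mB\<^sup>\<dagger>) \<circ> Q2)\<^sup>\<dagger>"
    by (simp only: Q2_coassoc)
  then have Q2_adj_assoc: "Q2\<^sup>\<dagger> \<circ> (Q2\<^sup>\<dagger> \<otimes>\<^sub>m id) \<circ> assoc_inv = Q2\<^sup>\<dagger> \<circ> (id \<otimes>\<^sub>m mB)"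
    by (simp add: adj_comp adj_tensor_map adj_id adj_adj adj_assoc comp_assoc)
  have "(id \<otimes>\<^sub>m P) \<circ> assoc \<circ> (P \<otimes>\<^sub>m id) \<circ> assoc_inv \<circ> (id \<otimes>\<^sub>m mB\<^sup>\<dagger>)
    = (id \<otimes>\<^sub>m Q1) \<circ> ((id \<otimes>\<^sub>m Q2\<^sup>\<dagger>) \<circ> assoc \<circ> (Q1 \<otimes>\<^sub>m id)) \<circ> (Q2\<^sup>\<dagger> \<otimes>\<^sub>m id)
      \<circ> assoc_inv \<circ> (id \<otimes>\<^sub>m mB\<^sup>\<dagger>)"
  proof -
    have "id \<otimes>\<^sub>m P = (id \<otimes>\<^sub>m Q1) \<circ> ((id :: 'a \<Rightarrow> 'a) \<otimes>\<^sub>m Q2\<^sup>\<dagger>)"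
      and "P \<otimes>\<^sub>m id = (Q1 \<otimes>\<^sub>m id) \<circ> (Q2\<^sup>\<dagger> \<otimes>\<^sub>m (id :: 'b \<Rightarrow> 'b))"
      by (simp_all add: P_def tensor_map_comp)
    then show ?thesis by (simp only: comp_assoc)
  qed
  \<comment> \<open>Sliding turns the alternating factors into two adjacent copies of
    \<open>Q1\<close> and two adjacent copies of \<open>Q2\<^sup>\<dagger>\<close>, so the coaction
    and action laws apply.\<close>
  also have "\<dots> = ((id \<otimes>\<^sub>m Q1) \<circ> Q1) \<circ> (Q2\<^sup>\<dagger> \<circ> (Q2\<^sup>\<dagger> \<otimes>\<^sub>m id) \<circ> assoc_inv) \<circ> (id \<otimes>\<^sub>m mB\<^sup>\<dagger>)"
    by (simp only: slide) (simp only: P_def comp_assoc)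
  also have "\<dots> = assoc \<circ> (mA\<^sup>\<dagger> \<otimes>\<^sub>m id) \<circ> P \<circ> ((id \<otimes>\<^sub>m mB) \<circ> (id \<otimes>\<^sub>m mB\<^sup>\<dagger>))"
    by (simp only: Q1_coassoc Q2_adj_assoc) (simp only: P_def comp_assoc)
  \<comment> \<open>Separability of \<open>B\<close> cancels the multiplication against its
    adjoint.\<close>
  also have "\<dots> = assoc \<circ> (mA\<^sup>\<dagger> \<otimes>\<^sub>m id) \<circ> P"
    by (simp add: tensor_map_comp sep tensor_map_id)
  finally have "assoc_inv \<circ> ((id \<otimes>\<^sub>m P) \<circ> assoc \<circ> (P \<otimes>\<^sub>m id) \<circ> assoc_inv \<circ> (id \<otimes>\<^sub>m mB\<^sup>\<dagger>))
    = (assoc_inv \<circ> assoc) \<circ> (mA\<^sup>\<dagger> \<otimes>\<^sub>m id) \<circ> P"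
    by (simp only: comp_assoc)
  then have mult: "(mA\<^sup>\<dagger> \<otimes>\<^sub>m id) \<circ> P =
      assoc_inv \<circ> (id \<otimes>\<^sub>m P) \<circ> assoc \<circ> (P \<otimes>\<^sub>m id) \<circ> assoc_inv \<circ> (id \<otimes>\<^sub>m mB\<^sup>\<dagger>)"
    by (simp add: assoc_inv_assoc comp_assoc)

  \<comment> \<open>The cup of \<open>B\<close> and the cap of \<open>A\<close>. Since
    \<open>\<delta>\<close> is the adjoint of \<open>iB\<^sup>\<dagger> \<circ> mB\<close>, the
    adjoint of \<open>Q2_real\<close> recovers \<open>Q2\<close> from
    \<open>Q2\<^sup>\<dagger>\<close> by means of \<open>\<delta>\<close>.\<close>
  define \<delta> where "\<delta> = mB\<^sup>\<dagger> \<circ> iB"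
  define \<epsilon> where "\<epsilon> = iA\<^sup>\<dagger> \<circ> mA"
  have [simp]: "clinear \<delta>" "clinear \<epsilon>" by (simp_all add: \<delta>_def \<epsilon>_def)
  have "Q2 = (runit \<circ> (id \<otimes>\<^sub>m (iB\<^sup>\<dagger> \<circ> mB)) \<circ> assoc \<circ> (Q2 \<otimes>\<^sub>m id))\<^sup>\<dagger>"
    by (simp only: Q2_real[symmetric]) (simp add: adj_adj)
  also have "\<dots> = (Q2\<^sup>\<dagger> \<otimes>\<^sub>m id) \<circ> assoc_inv \<circ> (id \<otimes>\<^sub>m \<delta>) \<circ> runit_inv"
    by (simp add: adj_comp adj_tensor_map adj_id adj_adj adj_assoc adj_runit \<delta>_def comp_assoc)
  finally have Q2: "(Q2\<^sup>\<dagger> \<otimes>\<^sub>m id) \<circ> assoc_inv \<circ> (id \<otimes>\<^sub>m \<delta>) \<circ> runit_inv = Q2" ..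

  \<comment> \<open>\<open>Q1_real\<close> with an inert \<open>B\<close> on the right:
    \<open>lunit_assoc\<close> and naturality bring every factor into the form
    \<open>_ \<otimes>\<^sub>m id\<close>.\<close>
  have left: "lunit \<circ> (\<epsilon> \<otimes>\<^sub>m id) \<circ> assoc \<circ> (assoc_inv \<otimes>\<^sub>m id) \<circ> ((id \<otimes>\<^sub>m Q1) \<otimes>\<^sub>m id)
    = Q1\<^sup>\<dagger> \<otimes>\<^sub>m (id :: 'b \<Rightarrow> 'b)"
  proof -
    have "lunit \<circ> (\<epsilon> \<otimes>\<^sub>m (id :: 'h \<otimes> 'b \<Rightarrow> _)) \<circ> assoc = lunit \<circ> assoc \<circ> ((\<epsilon> \<otimes>\<^sub>m id) \<otimes>\<^sub>m id)"
      by (simp add: comp_assoc assoc_natural tensor_map_id)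
    also have "\<dots> = (lunit \<circ> (\<epsilon> \<otimes>\<^sub>m id)) \<otimes>\<^sub>m id"
      by (simp add: lunit_assoc tensor_map_comp)
    finally show ?thesis
      by (simp add: tensor_map_comp Q1_real \<epsilon>_def)
  qed
  \<comment> \<open>The recovered formula for \<open>Q2\<close> with an inert \<open>A\<close> on
    the left: \<open>pentagon_inv\<close> and naturality bring every factor after
    \<open>assoc_inv\<close> into the form \<open>id \<otimes>\<^sub>m _\<close>.\<close>
  have right: "((id \<otimes>\<^sub>m Q2\<^sup>\<dagger>) \<otimes>\<^sub>m id) \<circ> (assoc \<otimes>\<^sub>m id) \<circ> assoc_inv \<circ> (id \<otimes>\<^sub>m \<delta>) \<circ> runit_inv
    = assoc_inv \<circ> ((id :: 'a \<Rightarrow> 'a) \<otimes>\<^sub>m Q2)"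
  proof -
    have "((id \<otimes>\<^sub>m Q2\<^sup>\<dagger>) \<otimes>\<^sub>m id) \<circ> (assoc \<otimes>\<^sub>m id) \<circ> assoc_inv \<circ> (id \<otimes>\<^sub>m \<delta>) \<circ> runit_inv
      = (((id \<otimes>\<^sub>m Q2\<^sup>\<dagger>) \<otimes>\<^sub>m id) \<circ> assoc_inv) \<circ> (id \<otimes>\<^sub>m assoc_inv)
        \<circ> (assoc \<circ> ((id :: 'a \<otimes> 'h \<Rightarrow> _) \<otimes>\<^sub>m \<delta>)) \<circ> runit_inv"
      by (simp add: pentagon_inv comp_assoc)
    also have "assoc \<circ> (id \<otimes>\<^sub>m \<delta>) = (id \<otimes>\<^sub>m (id \<otimes>\<^sub>m \<delta>)) \<circ> (assoc :: ('a \<otimes> 'h) \<otimes> _ \<Rightarrow> _)"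
      by (simp add: assoc_natural[symmetric] tensor_map_id)
    also have "((id \<otimes>\<^sub>m Q2\<^sup>\<dagger>) \<otimes>\<^sub>m id) \<circ> assoc_inv
        = assoc_inv \<circ> ((id :: 'a \<Rightarrow> 'a) \<otimes>\<^sub>m (Q2\<^sup>\<dagger> \<otimes>\<^sub>m (id :: 'b \<Rightarrow> 'b)))"
      by (simp add: assoc_inv_natural)
    also have "assoc_inv \<circ> (id \<otimes>\<^sub>m (Q2\<^sup>\<dagger> \<otimes>\<^sub>m id)) \<circ> (id \<otimes>\<^sub>m assoc_inv)
        \<circ> ((id \<otimes>\<^sub>m (id \<otimes>\<^sub>m \<delta>)) \<circ> assoc) \<circ> runit_inv
      = assoc_inv \<circ> ((id \<otimes>\<^sub>m (Q2\<^sup>\<dagger> \<otimes>\<^sub>m id)) \<circ> (id \<otimes>\<^sub>m assoc_inv)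
        \<circ> (id \<otimes>\<^sub>m (id \<otimes>\<^sub>m \<delta>)) \<circ> (assoc \<circ> (runit_inv :: 'a \<otimes> 'h \<Rightarrow> _)))"
      by (simp only: comp_assoc)
    also have "\<dots> = assoc_inv \<circ>
        (id \<otimes>\<^sub>m ((Q2\<^sup>\<dagger> \<otimes>\<^sub>m id) \<circ> assoc_inv \<circ> (id \<otimes>\<^sub>m \<delta>) \<circ> runit_inv))"
      by (simp add: assoc_runit_inv tensor_map_comp)
    finally show ?thesis by (simp only: Q2)
  qed

  \<comment> \<open>Using \<open>slide\<close> instead of the definition of \<open>P\<close> gives
    an adjoint in which \<open>Q1\<^sup>\<dagger>\<close> and \<open>Q2\<close> occur exactly as in
    \<open>left\<close> and \<open>right\<close>, rather than as
    \<open>Q2 \<circ> Q1\<^sup>\<dagger>\<close>.\<close>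
  have "P\<^sup>\<dagger> = ((id \<otimes>\<^sub>m Q2\<^sup>\<dagger>) \<circ> assoc \<circ> (Q1 \<otimes>\<^sub>m id))\<^sup>\<dagger>"
    by (simp only: slide)
  also have "\<dots> = (Q1\<^sup>\<dagger> \<otimes>\<^sub>m id) \<circ> (assoc_inv \<circ> (id \<otimes>\<^sub>m Q2))"
    by (simp add: adj_comp adj_tensor_map adj_id adj_adj adj_assoc comp_assoc)
  \<comment> \<open>Expanding both halves places \<open>Q1\<close> next to
    \<open>Q2\<^sup>\<dagger>\<close>, and these recombine to \<open>P\<close>.\<close>
  also have "\<dots> = lunit \<circ> (\<epsilon> \<otimes>\<^sub>m id) \<circ> assoc \<circ> (assoc_inv \<otimes>\<^sub>m id)
      \<circ> (((id \<otimes>\<^sub>m Q1) \<otimes>\<^sub>m id) \<circ> ((id \<otimes>\<^sub>m Q2\<^sup>\<dagger>) \<otimes>\<^sub>m id))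
      \<circ> (assoc \<otimes>\<^sub>m id) \<circ> assoc_inv \<circ> (id \<otimes>\<^sub>m \<delta>) \<circ> runit_inv"
    by (simp only: left[symmetric] right[symmetric] comp_assoc)
  also have "((id \<otimes>\<^sub>m Q1) \<otimes>\<^sub>m id) \<circ> ((id \<otimes>\<^sub>m Q2\<^sup>\<dagger>) \<otimes>\<^sub>m id)
      = ((id :: 'a \<Rightarrow> 'a) \<otimes>\<^sub>m P) \<otimes>\<^sub>m (id :: 'b \<Rightarrow> 'b)"
    by (simp add: tensor_map_comp P_def)
  finally show ?thesis
    using P mult unfolding nonunital_quantum_function_def P_def \<delta>_def \<epsilon>_def by blast
qed

end
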